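(* Consider the online setting on $k$ vertices with movement costs $\ell_{ij}=1$ for all $i\ne j$. For demand sequences $d$ with $\max_{i,t} d^t_i=1/\rho$, the randomized online algorithm $\mathrm{composite}(\sqrt{\rho/k})=\tfrac12\,\mathrm{stay}+\tfrac12\,\mathrm{rand}(\sqrt{\rho/k})$ is $\left(\frac{1}{2e}\sqrt{\frac{\rho}{k}}\right)$-competitive; that is, its expected social welfare on $d$ is at least $\frac{1}{2e}\sqrt{\rho/k}\cdot\max_{s}\mathrm{sw}(s,d)$.
   Context: $V$ is a set of $k$ vertices with distances $\ell_{ij}$. Time steps are $1,\dots,T$. A demand sequence is $d=(d^1,\dots,d^T)$ and a supply sequence is $s=(s^1,\dots,s^T)$, where each $d^t,s^t$ is a nonnegative vector indexed by $V$ with entries summing to $1$. The demand served at time $t$ is $\mathrm{ds}(s^t,d^t)=\sum_i\min(s^t_i,d^t_i)$. The earthmover distance $\mathrm{em}(s,s')$ is the minimum of $\sum_{u,v}f(u,v)\ell_{uv}$ over all $f\ge 0$ with $\sum_v f(u,v)=s_u$, $\sum_u f(u,v)=s'_v$. The social welfare is $\mathrm{sw}(s,d)=\sum_{t=1}^T\mathrm{ds}(s^t,d^t)-\sum_{t=2}^T\mathrm{em}(s^{t-1},s^t)$. An online algorithm chooses $s^t$ as a (possibly randomized) function of $d^1,\dots,d^t$. The parameter $\rho$ of a demand sequence is defined by $1/\rho=\max_{i,t}d^t_i$, so $1\le\rho\le k$. Algorithms: - $\mathrm{stay}$: $s^t=\langle 1/k,\dots,1/k\rangle$ for all $t$. -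 $\mathrm{rand}(p)$: $s^1=d^1$; for each $t>1$, (independently) with probability $p$ set $s^t=d^t$ and with probability $1-p$ set $s^t=s^{t-1}$. - $\mathrm{composite}(p)$: toss a fair coin; if heads run $\mathrm{stay}$, otherwise run $\mathrm{rand}(p)$. *)

theory Defs
  imports "HOL-Analysis.Analysis" "HOL-Probability.Probability"
begin

text \<open>
  The vertex set is a finite type \<open>'v\<close>, so \<open>k = CARD('v)\<close>. Sequences are indexed by all
  of \<open>nat\<close>, but only the time steps \<open>1, ..., T\<close> are meaningful.
\<close>

definition is_distribution :: "real ^ 'v::finite \<Rightarrow> bool" where
  "is_distribution x \<longleftrightarrow> (\<forall>i. x $ i \<ge> 0) \<and> (\<Sum>i\<in>UNIV. x $ i) = 1"

definition distribution_seqs :: "nat \<Rightarrow> (nat \<Rightarrow> real ^ 'v::finite) set" where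
  "distribution_seqs T = {x. \<forall>t\<in>{1..T}. is_distribution (x t)}"

definition demand_served :: "real ^ 'v::finite \<Rightarrow> real ^ 'v \<Rightarrow> real" where
  "demand_served s d = (\<Sum>i\<in>UNIV. min (s $ i) (d $ i))"

definition flows :: "real ^ 'v::finite \<Rightarrow> real ^ 'v \<Rightarrow> ('v \<Rightarrow> 'v \<Rightarrow> real) set" where
  "flows s s' = {f. (\<forall>u v. f u v \<ge> 0) \<and> (\<forall>u. (\<Sum>v\<in>UNIV. f u v) = s $ u)
                  \<and> (\<forall>v. (\<Sum>u\<in>UNIV. f u v) = s' $ v)}"

text \<open>For distributions the infimum is a minimum: the flows then form a nonempty compact set.\<close>

definition earthmover :: "('v::finite \<Rightarrow> 'v \<Rightarrow> real) \<Rightarrow> real ^ 'v \<Rightarrow> real ^ 'v \<Rightarrow> real" where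
  "earthmover l s s' = (INF f\<in>flows s s'. \<Sum>u\<in>UNIV. \<Sum>v\<in>UNIV. f u v * l u v)"

definition social_welfare ::
    "('v::finite \<Rightarrow> 'v \<Rightarrow> real) \<Rightarrow> nat \<Rightarrow> (nat \<Rightarrow> real ^ 'v) \<Rightarrow> (nat \<Rightarrow> real ^ 'v) \<Rightarrow> real" where
  "social_welfare l T s d =
     (\<Sum>t=1..T. demand_served (s t) (d t)) - (\<Sum>t=2..T. earthmover l (s (t - 1)) (s t))"

text \<open>The offline optimum; by compactness the supremum is a maximum.\<close>

definition opt_welfare :: "('v::finite \<Rightarrow> 'v \<Rightarrow> real) \<Rightarrow> nat \<Rightarrow> (nat \<Rightarrow> real ^ 'v) \<Rightarrow> real" where
  "opt_welfare l T d = (SUP s\<in>distribution_seqs T. social_welfare l T s d)"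

definition max_demand :: "nat \<Rightarrow> (nat \<Rightarrow> real ^ 'v::finite) \<Rightarrow> real" where
  "max_demand T d = Max {d t $ i | i t. t \<in> {1..T}}"

text \<open>
  A deterministic online algorithm maps the history \<open>[d 1, ..., d t]\<close> to the supply at time
  \<open>t\<close>; a randomized one is a probability distribution over deterministic ones.
\<close>

type_synonym 'v online_alg = "(real ^ 'v) list \<Rightarrow> real ^ 'v"

definition run_alg :: "'v::finite online_alg \<Rightarrow> (nat \<Rightarrow> real ^ 'v) \<Rightarrow> nat \<Rightarrow> real ^ 'v" where
  "run_alg A d t = A (map d [1..<Suc t])"

definition expected_welfare ::
    "('v::finite \<Rightarrow> 'v \<Rightarrow> real) \<Rightarrow> nat \<Rightarrow> 'v online_alg pmf \<Rightarrow> (nat \<Rightarrow> real ^ 'v) \<Rightarrow> real" where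
  "expected_welfare l T A d =
     measure_pmf.expectation A (\<lambda>a. social_welfare l T (run_alg a d) d)"

definition stay :: "'v::finite online_alg" where
  "stay h = (\<chi> i. 1 / real CARD('v))"

text \<open>
  \<open>c t\<close> says whether the supply is reset to the current demand at time \<open>t > 1\<close>, where \<open>t\<close>
  is the length of the history.
\<close>

fun follow :: "(nat \<Rightarrow> bool) \<Rightarrow> 'v::finite online_alg" where
  "follow c h = (if length h \<le> 1 \<or> c (length h) then last h else follow c (butlast h))"

declare follow.simps [simp del]

text \<open>The coins for the times \<open>2, ..., T\<close> are independent; the others are irrelevant.\<close>

definition rand_alg :: "nat \<Rightarrow> real \<Rightarrow> 'v::finite online_alg pmf" where
  "rand_alg T p = map_pmf follow (Pi_pmf {2..T} False (\<lambda>_. bernoulli_pmf p))"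

definition composite :: "nat \<Rightarrow> real \<Rightarrow> 'v::finite online_alg pmf" where
  "composite T p =
     bind_pmf (bernoulli_pmf (1/2)) (\<lambda>heads. if heads then return_pmf stay else rand_alg T p)"

end

theory Submission
  imports Defs
begin

text \<open>
  For unit lengths, moving from \<open>x\<close> to \<open>y\<close> costs one minus their overlap. Hence the movement cost of
  a reset cancels against the gain in demand served: on every coin sequence, following the demand
  earns 1 plus the overlaps of each demand with the supply of the preceding step. Writing each
  overlap \<open>min a b\<close> as an integral over levels reduces the offline optimum to 0/1 sequences at a
  single vertex. There, if a supply token serves two demands \<open>g\<close> steps apart, the random algorithm
  still holds the earlier one with probability at least \<open>p (1 - p)\<^sup>g\<^sup>-\<^sup>1\<close>, and staying earns \<open>p\<^sup>2\<close> in
  each of the \<open>g\<close> steps. By Bernoulli's inequality the two together earn at least \<open>p\<close>. This yields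
  the ratio \<open>p / 2\<close>, stronger than \<open>p / (2 e)\<close>.
\<close>

section \<open>Earthmover distance for unit lengths\<close>

lemma demand_served_le_1:
  assumes "is_distribution x"
  shows "demand_served x y \<le> 1"
proof -
  have "demand_served x y \<le> (\<Sum>i\<in>UNIV. x $ i)"
    unfolding demand_served_def by (intro sum_mono) auto
  then show ?thesis using assms by (simp add: is_distribution_def)
qed

lemma demand_served_nonneg:
  assumes "is_distribution x" "is_distribution y"
  shows "demand_served x y \<ge> 0"
  using assms unfolding demand_served_def is_distribution_def by (intro sum_nonneg) auto

lemma demand_served_self: "is_distribution x \<Longrightarrow> demand_served x x = 1"
  by (simp add: demand_served_def is_distribution_def)

text \<open>All mass off the diagonal costs 1 per unit, and the total mass is 1.\<close>

lemma flow_cost_unit: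
  fixes l :: "'v::finite \<Rightarrow> 'v \<Rightarrow> real"
  assumes "\<And>i. l i i = 0" "\<And>i j. i \<noteq> j \<Longrightarrow> l i j = 1"
    and "is_distribution x" "f \<in> flows x y"
  shows "(\<Sum>u\<in>UNIV. \<Sum>v\<in>UNIV. f u v * l u v) = 1 - (\<Sum>u\<in>UNIV. f u u)"
proof -
  have "(\<Sum>v\<in>UNIV. f u v * l u v) = x $ u - f u u" for u
  proof -
    have "(\<Sum>v\<in>UNIV. f u v * l u v) = (\<Sum>v\<in>UNIV. f u v - (if u = v then f u v else 0))"
      by (intro sum.cong) (auto simp: assms)
    also have "\<dots> = x $ u - f u u"
      using assms(4) by (simp add: sum_subtractf flows_def)
    finally show ?thesis .
  qed
  then show ?thesis using assms(3) by (simp add: sum_subtractf is_distribution_def)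
qed

text \<open>The flow keeps the common mass in place and ships the excess proportionally; when there is no
  excess, the division by zero yields the correct value 0.\<close>

lemma flow_keeping_overlap:
  fixes x y :: "real ^ 'v::finite"
  assumes "is_distribution x" "is_distribution y"
  obtains f where "f \<in> flows x y" "\<And>u. f u u \<ge> min (x $ u) (y $ u)"
proof -
  define m where "m u = min (x $ u) (y $ u)" for u
  define r where "r = 1 - demand_served x y"
  define f where "f u v = (if u = v then m u else 0) + (x $ u - m u) * (y $ v - m v) / r" for u v
  have r: "r \<ge> 0" using demand_served_le_1[OF assms(1)] by (simp add: r_def)
  have m: "m u \<le> x $ u" "m u \<le> y $ u" "m u \<ge> 0" for u
    using assms by (auto simp: m_def is_distribution_def)
  have sx: "(\<Sum>u\<in>UNIV. x $ u - m u) = r" and sy: "(\<Sum>u\<in>UNIV. y $ u - m u) = r"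
    using assms by (simp_all add: sum_subtractf is_distribution_def r_def m_def demand_served_def)
  have zx: "x $ u - m u = 0" and zy: "y $ u - m u = 0" if "r = 0" for u
    using sx sy that m by (simp_all add: sum_nonneg_eq_0_iff)
  have nonneg: "(x $ u - m u) * (y $ v - m v) / r \<ge> 0" for u v
    using m r by (simp add: mult_nonneg_nonneg)
  have "(\<Sum>v\<in>UNIV. f u v) = x $ u" for u
  proof -
    have "(\<Sum>v\<in>UNIV. f u v) = m u + (x $ u - m u) * (\<Sum>v\<in>UNIV. y $ v - m v) / r"
      by (simp add: f_def sum.distrib sum_distrib_left sum_divide_distrib)
    then show ?thesis using sy zx[of u] by (cases "r = 0") auto
  qed
  moreover have "(\<Sum>u\<in>UNIV. f u v) = y $ v" for v
  proof -
    have "(\<Sum>u\<in>UNIV. f u v) = m v + (\<Sum>u\<in>UNIV. x $ u - m u) * (y $ v - m v) / r"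
      by (simp add: f_def sum.distrib sum_distrib_right sum_divide_distrib)
    then show ?thesis using sx zy[of v] by (cases "r = 0") auto
  qed
  moreover have "f u v \<ge> 0" for u v
    unfolding f_def using m(3) nonneg by (intro add_nonneg_nonneg) auto
  ultimately have "f \<in> flows x y" by (simp add: flows_def)
  moreover have "f u u \<ge> min (x $ u) (y $ u)" for u
    using nonneg[of u u] by (simp add: f_def m_def)
  ultimately show ?thesis using that by blast
qed

lemma flow_le_min:
  assumes "f \<in> flows x y"
  shows "f u u \<le> min (x $ u) (y $ u)"
proof -
  have nn: "f a b \<ge> 0" for a b using assms by (simp add: flows_def)
  have "f u u \<le> (\<Sum>v\<in>UNIV. f u v)" "f u u \<le> (\<Sum>v\<in>UNIV. f v u)"
    by (rule member_le_sum[of u UNIV "f u"] member_le_sum[of u UNIV "\<lambda>v. f v u"]; simp add: nn)+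
  then show ?thesis using assms by (simp add: flows_def)
qed

text \<open>A flow costs one minus the mass it keeps in place, and at each vertex at most the
  \<open>min\<close> of the two entries can stay.\<close>

lemma earthmover_unit:
  fixes l :: "'v::finite \<Rightarrow> 'v \<Rightarrow> real"
  assumes l: "\<And>i. l i i = 0" "\<And>i j. i \<noteq> j \<Longrightarrow> l i j = 1"
    and dist: "is_distribution x" "is_distribution y"
  shows "earthmover l x y = 1 - demand_served x y"
proof -
  obtain f where f: "f \<in> flows x y" "\<And>u. f u u \<ge> min (x $ u) (y $ u)"
    using flow_keeping_overlap[OF dist] by blast
  note cost = flow_cost_unit[OF l dist(1)]
  have lower: "(\<Sum>u\<in>UNIV. \<Sum>v\<in>UNIV. g u v * l u v) \<ge> 1 - demand_served x y"
    if "g \<in> flows x y" for g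
    using that flow_le_min[OF that] by (simp add: cost demand_served_def sum_mono)
  have "earthmover l x y \<le> (\<Sum>u\<in>UNIV. \<Sum>v\<in>UNIV. f u v * l u v)"
    unfolding earthmover_def using f(1) lower by (intro cINF_lower bdd_belowI2) auto
  also have "\<dots> \<le> 1 - demand_served x y"
    using f by (simp add: cost demand_served_def sum_mono)
  finally have "earthmover l x y \<le> 1 - demand_served x y" .
  moreover have "earthmover l x y \<ge> 1 - demand_served x y"
    unfolding earthmover_def using f(1) lower by (intro cINF_greatest) auto
  ultimately show ?thesis by simp
qed

text \<open>Step \<open>n\<close> stands for time \<open>Suc n\<close>, so that inductions start at
  0 and no predecessors occur.\<close>

lemma social_welfare_unit:
  fixes l :: "'v::finite \<Rightarrow> 'v \<Rightarrow> real"
  assumes l: "\<And>i. l i i = 0" "\<And>i j. i \<noteq> j \<Longrightarrow> l i j = 1"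
    and s: "s \<in> distribution_seqs (Suc N)"
  shows "social_welfare l (Suc N) s d =
    (\<Sum>n\<le>N. demand_served (s (Suc n)) (d (Suc n)))
      - (\<Sum>n<N. 1 - demand_served (s (Suc n)) (s (Suc (Suc n))))"
proof -
  have "(\<Sum>t=2..Suc N. earthmover l (s (t - 1)) (s t))
      = (\<Sum>n<N. earthmover l (s (Suc n)) (s (Suc (Suc n))))"
    by (rule sum.reindex_bij_witness[of _ "\<lambda>n. n + 2" "\<lambda>t. t - 2"])
      (auto simp: numeral_2_eq_2 Suc_diff_Suc)
  also have "\<dots> = (\<Sum>n<N. 1 - demand_served (s (Suc n)) (s (Suc (Suc n))))"
    using s by (intro sum.cong earthmover_unit refl l) (auto simp: distribution_seqs_def)
  moreover have "(\<Sum>t=1..Suc N. demand_served (s t) (d t))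
      = (\<Sum>n\<le>N. demand_served (s (Suc n)) (d (Suc n)))"
    by (simp only: One_nat_def sum.shift_bounds_cl_Suc_ivl atMost_atLeast0)
  ultimately show ?thesis by (simp add: social_welfare_def)
qed

section \<open>Bounding the offline optimum\<close>

text \<open>The mean of \<open>a\<close> at the last reset before or at time \<open>n\<close>, when each positive time is a reset
  with probability \<open>p\<close> and time 0 always is.\<close>

primrec smooth :: "real \<Rightarrow> (nat \<Rightarrow> real) \<Rightarrow> nat \<Rightarrow> real" where
  "smooth p a 0 = a 0"
| "smooth p a (Suc n) = p * a (Suc n) + (1 - p) * smooth p a n"

lemma smooth_nonneg: "0 \<le> p \<Longrightarrow> p \<le> 1 \<Longrightarrow> (\<And>m. m \<le> n \<Longrightarrow> a m \<ge> 0) \<Longrightarrow> smooth p a n \<ge> 0"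
  by (induction n) auto

lemma smooth_sum: "smooth p (\<lambda>m. \<Sum>i\<in>I. a i m) n = (\<Sum>i\<in>I. smooth p (a i) n)"
  by (induction n) (simp_all add: sum.distrib sum_distrib_left)

lemma smooth_mult_right: "smooth p (\<lambda>m. a m * c) n = smooth p a n * c"
  by (induction n) (simp_all add: algebra_simps)

lemma has_integral_smooth:
  assumes "\<And>m. m \<le> n \<Longrightarrow> ((\<lambda>y. a y m) has_integral b m) A"
  shows "((\<lambda>y. smooth p (a y) n) has_integral smooth p b n) A"
  using assms by (induction n) (auto intro!: has_integral_add has_integral_mult_right)

text \<open>A supply token sits at the vertex when \<open>S\<close> holds, a demand token when \<open>D\<close> does. The credit
  added to the left-hand side is at most \<open>p\<close> times the waiting time since the last demand, because
  \<open>(1 - p) ^ g \<ge> 1 - p * g\<close>; the next demand spends it.\<close>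

lemma token_bound_credit:
  fixes S D :: "nat \<Rightarrow> bool" and p :: real
  assumes p: "0 < p" "p \<le> 1"
  shows "(\<Sum>n\<le>N. of_bool (S n) * of_bool (D n))
      - (\<Sum>n<N. of_bool (S (Suc n)) * (1 - of_bool (S n))) - of_bool (S 0)
      + of_bool (S N) * (1 - min 1 (smooth p (\<lambda>n. of_bool (D n)) N / p))
    \<le> p * (\<Sum>n\<le>N. of_bool (S n))
      + (1 / p) * (\<Sum>n<N. smooth p (\<lambda>n. of_bool (D n)) n * of_bool (D (Suc n)))"
proof (induction N)
  case 0
  show ?case using p by (auto simp: min_def)
next
  case (Suc N)
  \<comment> \<open>In this scale a demand lifts the value to at least 1, which resets the credit to
    0; each step without demand multiplies it by \<open>1 - p\<close>.\<close>
  define v where "v = smooth p (\<lambda>n. of_bool (D n)) N / p"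
  have v: "v \<ge> 0"
    using p by (simp add: v_def smooth_nonneg)
  have upd: "smooth p (\<lambda>n. of_bool (D n)) (Suc N) / p = of_bool (D (Suc N)) + (1 - p) * v"
    using p by (simp add: v_def field_simps)
  \<comment> \<open>One step of waiting raises the credit by at most \<open>p\<close>, the amount
    that the bound gains for holding a token.\<close>
  have decay: "1 - min 1 ((1 - p) * v) \<le> p + (1 - min 1 v)"
  proof (cases "v \<le> 1")
    case True
    then have "p * v \<le> p" using p by (simp add: mult_left_le)
    moreover have "(1 - p) * v \<le> 1" using True v p by (simp add: mult_le_one)
    ultimately show ?thesis using True by (simp add: algebra_simps)
  next
    case False
    then have "(1 - p) * v \<ge> 1 - p" using p mult_left_mono[of 1 v "1 - p"] by simp
    then show ?thesis using p by auto
  qed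
  have pv: "(1 - p) * v \<ge> 0" using p v by simp
  \<comment> \<open>The increments at the new step. An arriving token pays 1, which covers a demand
    or the new credit. A kept token that meets a demand draws \<open>v\<close> from the last sum and
    the rest from its old credit; without a demand, \<open>decay\<close> applies.\<close>
  have "of_bool (S (Suc N)) * of_bool (D (Suc N))
      - of_bool (S (Suc N)) * (1 - of_bool (S N))
      + of_bool (S (Suc N)) * (1 - min 1 (of_bool (D (Suc N)) + (1 - p) * v))
    \<le> p * of_bool (S (Suc N)) + v * of_bool (D (Suc N)) + of_bool (S N) * (1 - min 1 v)"
    using p v pv decay by (cases "S (Suc N)"; cases "S N"; cases "D (Suc N)") auto
  with Suc.IH show ?case
    unfolding upd sum.atMost_Suc sum.lessThan_Suc distrib_left v_def[symmetric] by (simp add: v_def)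
qed

text \<open>The credit is nonnegative and is dropped. Products of at most two indicators remain
  inside the sums and \<open>smooth\<close>; over levels they integrate to an entry or to a
  \<open>min\<close> of two.\<close>

lemma token_bound:
  fixes S D :: "nat \<Rightarrow> bool" and p :: real
  assumes "0 < p" "p \<le> 1"
  shows "(\<Sum>n\<le>N. of_bool (S n) * of_bool (D n))
      - (\<Sum>n<N. of_bool (S (Suc n)) - of_bool (S (Suc n)) * of_bool (S n)) - of_bool (S 0)
    \<le> p * (\<Sum>n\<le>N. of_bool (S n))
      + (1 / p) * (\<Sum>n<N. smooth p (\<lambda>m. of_bool (D m) * of_bool (D (Suc n))) n)"
proof -
  have "of_bool (S N) * (1 - min 1 (smooth p (\<lambda>n. of_bool (D n)) N / p)) \<ge> 0"
    by simp
  with token_bound_credit[OF assms, where N = N and S = S and D = D] show ?thesis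
    unfolding smooth_mult_right by (simp only: right_diff_distrib mult_1_right)
qed

section \<open>From 0/1 sequences to fractional ones\<close>

lemma has_integral_level:
  fixes a :: real
  assumes "0 \<le> a" "a \<le> 1"
  shows "((\<lambda>y. of_bool (y < a)) has_integral a) {0..1}"
proof -
  have "((\<lambda>y. 1::real) has_integral a) {0..a}"
    using has_integral_const_real[of "1::real" 0 a] assms by simp
  then have "((\<lambda>y. if y \<in> {0..a} then 1 else 0 :: real) has_integral a) {0..1}"
    using assms by (subst has_integral_restrict) auto
  then show ?thesis
    \<comment> \<open>The strict and the closed level set differ only at \<open>a\<close>.\<close>
    by (rule has_integral_spike[OF negligible_sing[of a], rotated]) (use assms in auto)
qed

lemma has_integral_level2:
  fixes a b :: real
  assumes "0 \<le> a" "a \<le> 1" "0 \<le> b" "b \<le> 1"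
  shows "((\<lambda>y. of_bool (y < a) * of_bool (y < b)) has_integral min a b) {0..1}"
proof -
  have "(\<lambda>y. of_bool (y < a) * of_bool (y < b) :: real) = (\<lambda>y. of_bool (y < min a b))"
    by auto
  then show ?thesis using has_integral_level[of "min a b"] assms by simp
qed

text \<open>At each level \<open>y\<close>, the entries above \<open>y\<close> form 0/1 sequences
  that obey \<open>token_bound\<close>; the inequality is integrated over \<open>y\<close>. Since
  \<open>smooth\<close> is linear, it commutes with the integral.\<close>

lemma vertex_bound:
  fixes s d :: "nat \<Rightarrow> real"
  assumes p: "0 < p" "p \<le> 1"
    and s: "\<And>n. n \<le> N \<Longrightarrow> s n \<in> {0..1}" and d: "\<And>n. n \<le> N \<Longrightarrow> d n \<in> {0..1}"
  shows "(\<Sum>n\<le>N. min (s n) (d n)) - (\<Sum>n<N. s (Suc n) - min (s (Suc n)) (s n)) - s 0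
    \<le> p * (\<Sum>n\<le>N. s n) + (1 / p) * (\<Sum>n<N. smooth p (\<lambda>m. min (d m) (d (Suc n))) n)"
proof (rule has_integral_le)
  show "((\<lambda>y. (\<Sum>n\<le>N. of_bool (y < s n) * of_bool (y < d n))
      - (\<Sum>n<N. of_bool (y < s (Suc n)) - of_bool (y < s (Suc n)) * of_bool (y < s n))
      - of_bool (y < s 0))
    has_integral
      (\<Sum>n\<le>N. min (s n) (d n)) - (\<Sum>n<N. s (Suc n) - min (s (Suc n)) (s n)) - s 0) {0..1}"
    using s d
    by (intro has_integral_diff has_integral_sum has_integral_level has_integral_level2) auto
  show "((\<lambda>y. p * (\<Sum>n\<le>N. of_bool (y < s n)) + (1 / p) *
      (\<Sum>n<N. smooth p (\<lambda>m. of_bool (y < d m) * of_bool (y < d (Suc n))) n))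
    has_integral
      p * (\<Sum>n\<le>N. s n) + (1 / p) * (\<Sum>n<N. smooth p (\<lambda>m. min (d m) (d (Suc n))) n)) {0..1}"
    using s d
    by (intro has_integral_add has_integral_mult_right has_integral_sum has_integral_smooth
        has_integral_level has_integral_level2) auto
qed (rule token_bound[OF p])

lemma is_distribution_component:
  assumes "is_distribution x"
  shows "x $ i \<in> {0..1}"
  using assms member_le_sum[of i UNIV "\<lambda>i. x $ i"] by (auto simp: is_distribution_def)

text \<open>\<open>vertex_bound\<close> summed over the vertices: the increases of the supply add up
  to the movement cost, and its mass is 1 at every step.\<close>

lemma supply_bound:
  fixes s d :: "nat \<Rightarrow> real ^ 'v::finite"
  assumes p: "0 < p" "p \<le> 1"
    and s: "\<And>n. n \<le> N \<Longrightarrow> is_distribution (s n)" and d: "\<And>n. n \<le> N \<Longrightarrow> is_distribution (d n)"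
  shows "(\<Sum>n\<le>N. demand_served (s n) (d n)) - (\<Sum>n<N. 1 - demand_served (s n) (s (Suc n))) - 1
    \<le> p * real (Suc N) + (1 / p) * (\<Sum>n<N. smooth p (\<lambda>m. demand_served (d m) (d (Suc n))) n)"
proof -
  have mass: "(\<Sum>i\<in>UNIV. s n $ i) = 1" if "n \<le> N" for n
    using s[OF that] by (simp add: is_distribution_def)
  have "(\<Sum>i\<in>UNIV. (\<Sum>n\<le>N. min (s n $ i) (d n $ i))
        - (\<Sum>n<N. s (Suc n) $ i - min (s (Suc n) $ i) (s n $ i)) - s 0 $ i)
      = (\<Sum>n\<le>N. \<Sum>i\<in>UNIV. min (s n $ i) (d n $ i))
        - (\<Sum>n<N. \<Sum>i\<in>UNIV. s (Suc n) $ i - min (s (Suc n) $ i) (s n $ i)) - (\<Sum>i\<in>UNIV. s 0 $ i)"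
    by (simp only: sum_subtractf sum.swap[of _ UNIV])
  also have "\<dots> = (\<Sum>n\<le>N. demand_served (s n) (d n))
        - (\<Sum>n<N. 1 - demand_served (s n) (s (Suc n))) - 1"
    by (simp add: sum_subtractf mass demand_served_def min.commute)
  finally have lhs: "(\<Sum>i\<in>UNIV. (\<Sum>n\<le>N. min (s n $ i) (d n $ i))
        - (\<Sum>n<N. s (Suc n) $ i - min (s (Suc n) $ i) (s n $ i)) - s 0 $ i) = \<dots>" .
  have "(\<Sum>i\<in>UNIV. p * (\<Sum>n\<le>N. s n $ i)
        + (1 / p) * (\<Sum>n<N. smooth p (\<lambda>m. min (d m $ i) (d (Suc n) $ i)) n))
      = p * (\<Sum>n\<le>N. \<Sum>i\<in>UNIV. s n $ i)
        + (1 / p) * (\<Sum>n<N. \<Sum>i\<in>UNIV. smooth p (\<lambda>m. min (d m $ i) (d (Suc n) $ i)) n)"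
    by (simp only: sum.distrib sum_distrib_left[symmetric] sum.swap[of _ UNIV])
  also have "\<dots> = p * real (Suc N)
        + (1 / p) * (\<Sum>n<N. smooth p (\<lambda>m. demand_served (d m) (d (Suc n))) n)"
    by (simp add: mass demand_served_def smooth_sum)
  finally have rhs: "(\<Sum>i\<in>UNIV. p * (\<Sum>n\<le>N. s n $ i)
        + (1 / p) * (\<Sum>n<N. smooth p (\<lambda>m. min (d m $ i) (d (Suc n) $ i)) n)) = \<dots>" .
  show ?thesis
    unfolding lhs[symmetric] rhs[symmetric]
    by (intro sum_mono vertex_bound p is_distribution_component s d)
qed

section \<open>Welfare of the two online algorithms\<close>

lemma follow_append:
  "follow c (h @ [x]) = (if h = [] \<or> c (Suc (length h)) then x else follow c h)"
  by (subst follow.simps) auto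

lemma run_follow_1: "run_alg (follow c) d (Suc 0) = d (Suc 0)"
  by (simp add: run_alg_def follow.simps)

lemma run_follow_Suc:
  "run_alg (follow c) d (Suc (Suc n)) =
    (if c (Suc (Suc n)) then d (Suc (Suc n)) else run_alg (follow c) d (Suc n))"
proof -
  have "map d [1..<Suc (Suc (Suc n))] = map d [1..<Suc (Suc n)] @ [d (Suc (Suc n))]"
    by simp
  then show ?thesis unfolding run_alg_def by (simp only: follow_append) (simp del: upt_Suc)
qed

text \<open>Later coins cannot affect the supply; this makes the coin of the last step separable in
  expectations.\<close>

lemma run_follow_cong:
  "(\<And>m. m \<le> Suc n \<Longrightarrow> c m = c' m) \<Longrightarrow>
    run_alg (follow c) d (Suc n) = run_alg (follow c') d (Suc n)"
  by (induction n) (simp_all add: run_follow_1 run_follow_Suc)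

lemma run_follow_distribution:
  assumes "d \<in> distribution_seqs T" "Suc n \<le> T"
  shows "is_distribution (run_alg (follow c) d (Suc n))"
  using assms by (induction n) (auto simp: run_follow_1 run_follow_Suc distribution_seqs_def)

text \<open>A reset serves 1 and costs one minus the overlap of the old supply with the new demand;
  without a reset nothing moves and exactly this overlap is served. The first step earns 1.\<close>

lemma social_welfare_follow:
  fixes l :: "'v::finite \<Rightarrow> 'v \<Rightarrow> real"
  assumes l: "\<And>i. l i i = 0" "\<And>i j. i \<noteq> j \<Longrightarrow> l i j = 1"
    and d: "d \<in> distribution_seqs (Suc N)"
  shows "social_welfare l (Suc N) (run_alg (follow c) d) d =
    1 + (\<Sum>n<N. demand_served (run_alg (follow c) d (Suc n)) (d (Suc (Suc n))))"
proof -
  let ?s = "run_alg (follow c) d"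
  have dd: "is_distribution (d (Suc n))" if "n \<le> N" for n
    using d that by (auto simp: distribution_seqs_def)
  have ss: "is_distribution (?s (Suc n))" if "n \<le> N" for n
    using run_follow_distribution[OF d] that by simp
  have "?s \<in> distribution_seqs (Suc N)"
    unfolding distribution_seqs_def
    using ss by (auto simp: Suc_le_eq gr0_conv_Suc)
  then have "social_welfare l (Suc N) ?s d = demand_served (?s (Suc 0)) (d (Suc 0)) +
      (\<Sum>n<N. demand_served (?s (Suc (Suc n))) (d (Suc (Suc n)))
        - (1 - demand_served (?s (Suc n)) (?s (Suc (Suc n)))))"
    using l by (simp add: social_welfare_unit sum.atMost_shift sum_subtractf)
  also have "(\<Sum>n<N. demand_served (?s (Suc (Suc n))) (d (Suc (Suc n)))
        - (1 - demand_served (?s (Suc n)) (?s (Suc (Suc n)))))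
      = (\<Sum>n<N. demand_served (?s (Suc n)) (d (Suc (Suc n))))"
    using ss dd by (intro sum.cong) (auto simp: run_follow_Suc demand_served_self)
  finally show ?thesis
    using dd by (simp add: run_follow_1 demand_served_self)
qed

section \<open>Expectations over the coins\<close>

lemma finite_set_coins: "finite A \<Longrightarrow> finite (set_pmf (Pi_pmf A dflt (\<lambda>_. q :: bool pmf)))"
  by (simp add: set_Pi_pmf finite_PiE_dflt)

text \<open>Conditioning on the coin of the last time gives the recursion of \<open>smooth\<close>.
  The coin set \<open>A\<close> is arbitrary so that the induction may remove that coin and keep the
  others, including later ones.\<close>

lemma expectation_follow:
  assumes p: "0 \<le> p" "p \<le> 1" and A: "finite A" "{2..Suc n} \<subseteq> A"
  shows "measure_pmf.expectation (Pi_pmf A False (\<lambda>_. bernoulli_pmf p))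
      (\<lambda>c. \<phi> (run_alg (follow c) d (Suc n)) :: real) = smooth p (\<lambda>m. \<phi> (d (Suc m))) n"
  using A
proof (induction n arbitrary: A)
  case 0
  then show ?case by (simp add: run_follow_1)
next
  case (Suc n)
  let ?t = "Suc (Suc n)" and ?B = "A - {Suc (Suc n)}"
  let ?P = "\<lambda>A. Pi_pmf A False (\<lambda>_. bernoulli_pmf p)"
  have "A = insert ?t ?B" using Suc.prems by auto
  then have "?P A = bernoulli_pmf p \<bind> (\<lambda>b. map_pmf (\<lambda>c. c(?t := b)) (?P ?B))"
    using Pi_pmf_insert'[of ?B ?t False "\<lambda>_. bernoulli_pmf p"] Suc.prems(1)
    by (simp add: map_pmf_def)
  then have "measure_pmf.expectation (?P A) (\<lambda>c. \<phi> (run_alg (follow c) d ?t)) =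
      p * \<phi> (d ?t) + (1 - p) *
        measure_pmf.expectation (?P ?B) (\<lambda>c. \<phi> (run_alg (follow (c(?t := False))) d (Suc n)))"
    using p Suc.prems(1)
    by (simp only:, subst pmf_expectation_bind[where A = UNIV])
      (auto simp: finite_set_coins UNIV_bool run_follow_Suc)
  also have "(\<lambda>c. \<phi> (run_alg (follow (c(?t := False))) d (Suc n)))
      = (\<lambda>c. \<phi> (run_alg (follow c) d (Suc n)))"
    by (intro ext arg_cong[of _ _ \<phi>] run_follow_cong) auto
  also have "measure_pmf.expectation (?P ?B) \<dots> = smooth p (\<lambda>m. \<phi> (d (Suc m))) n"
    using Suc.prems by (intro Suc.IH) auto
  finally show ?case by simp
qed

lemma expected_welfare_rand:
  fixes l :: "'v::finite \<Rightarrow> 'v \<Rightarrow> real"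
  assumes l: "\<And>i. l i i = 0" "\<And>i j. i \<noteq> j \<Longrightarrow> l i j = 1"
    and d: "d \<in> distribution_seqs (Suc N)" and p: "0 \<le> p" "p \<le> 1"
  shows "expected_welfare l (Suc N) (rand_alg (Suc N) p) d =
    1 + (\<Sum>n<N. smooth p (\<lambda>m. demand_served (d (Suc m)) (d (Suc (Suc n)))) n)"
proof -
  let ?P = "Pi_pmf {2..Suc N} False (\<lambda>_. bernoulli_pmf p)"
  have int: "integrable (measure_pmf ?P) g" for g :: "_ \<Rightarrow> real"
    by (intro integrable_measure_pmf_finite finite_set_coins) simp
  have "expected_welfare l (Suc N) (rand_alg (Suc N) p) d = measure_pmf.expectation ?P
      (\<lambda>c. 1 + (\<Sum>n<N. demand_served (run_alg (follow c) d (Suc n)) (d (Suc (Suc n)))))"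
    by (simp add: expected_welfare_def rand_alg_def social_welfare_follow[OF l d])
  also have "\<dots> = 1 + (\<Sum>n<N. measure_pmf.expectation ?P
      (\<lambda>c. demand_served (run_alg (follow c) d (Suc n)) (d (Suc (Suc n)))))"
    by (simp add: int Bochner_Integration.integral_add Bochner_Integration.integral_sum)
  also have "\<dots> = 1 + (\<Sum>n<N. smooth p (\<lambda>m. demand_served (d (Suc m)) (d (Suc (Suc n)))) n)"
    by (intro arg_cong2[of _ _ _ _ "(+)"] sum.cong refl expectation_follow[OF p,
          where \<phi> = "\<lambda>x. demand_served x (d (Suc (Suc n)))" for n]) auto
  finally show ?thesis .
qed

lemma expected_welfare_composite:
  "expected_welfare l T (composite T p) d =
    (social_welfare l T (run_alg stay d) d + expected_welfare l T (rand_alg T p) d) / 2"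
proof -
  have "finite (set_pmf (rand_alg T p :: 'a online_alg pmf))"
    by (simp add: rand_alg_def finite_set_coins)
  then show ?thesis
    unfolding expected_welfare_def composite_def
    by (subst pmf_expectation_bind[where A = UNIV]) (auto simp: UNIV_bool)
qed

text \<open>Nothing moves, and an entry \<open>x\<close> of the demand with
  \<open>0 \<le> x \<le> 1 / \<rho>\<close> is served at least the fraction
  \<open>\<rho> / k\<close> of \<open>x\<close>, where \<open>k\<close> is the number of
  vertices.\<close>

lemma social_welfare_stay:
  fixes l :: "'v::finite \<Rightarrow> 'v \<Rightarrow> real"
  assumes l: "\<And>i. l i i = 0" "\<And>i j. i \<noteq> j \<Longrightarrow> l i j = 1"
    and d: "d \<in> distribution_seqs (Suc N)"
    and \<rho>: "0 < \<rho>" "\<rho> \<le> real CARD('v)"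
    and le: "\<And>n i. n \<le> N \<Longrightarrow> d (Suc n) $ i \<le> 1 / \<rho>"
  shows "social_welfare l (Suc N) (run_alg stay d) d \<ge> real (Suc N) * (\<rho> / real CARD('v))"
proof -
  let ?u = "(\<chi> i. 1 / real CARD('v)) :: real ^ 'v"
  have stay: "run_alg stay d = (\<lambda>_. ?u)" by (simp add: run_alg_def stay_def fun_eq_iff)
  have u: "is_distribution ?u" by (simp add: is_distribution_def)
  have "demand_served ?u (d (Suc n)) \<ge> \<rho> / real CARD('v)" if n: "n \<le> N" for n
  proof -
    have dn: "is_distribution (d (Suc n))" using d n by (auto simp: distribution_seqs_def)
    have "\<rho> / real CARD('v) * d (Suc n) $ i \<le> min (1 / real CARD('v)) (d (Suc n) $ i)" for i
    proof -
      have nn: "d (Suc n) $ i \<ge> 0" using dn by (simp add: is_distribution_def)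
      moreover have "\<rho> * d (Suc n) $ i \<le> 1" using le[OF n, of i] \<rho> by (simp add: field_simps)
      moreover have "\<rho> * d (Suc n) $ i \<le> real CARD('v) * d (Suc n) $ i"
        using \<rho> nn by (intro mult_right_mono)
      ultimately show ?thesis
        using \<rho> by (auto simp: divide_simps mult.commute)
    qed
    then have "(\<Sum>i\<in>UNIV. \<rho> / real CARD('v) * d (Suc n) $ i) \<le> demand_served ?u (d (Suc n))"
      unfolding demand_served_def by (intro sum_mono) simp
    then show ?thesis using dn unfolding sum_distrib_left[symmetric] by (simp add: is_distribution_def)
  qed
  then have "(\<Sum>n\<le>N. demand_served ?u (d (Suc n))) \<ge> (\<Sum>n\<le>N. \<rho> / real CARD('v))"
    by (intro sum_mono) simp
  moreover have "(\<lambda>_. ?u) \<in> distribution_seqs (Suc N)" by (simp add: distribution_seqs_def u)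
  ultimately show ?thesis
    by (simp add: stay social_welfare_unit[OF l] demand_served_self[OF u])
qed

section \<open>The demand parameter and the competitive ratio\<close>

lemma max_demand_ge:
  fixes d :: "nat \<Rightarrow> real ^ 'v::finite"
  assumes "t \<in> {1..T}"
  shows "d t $ i \<le> max_demand T d"
proof -
  have "{d t $ i | i t. t \<in> {1..T}} = (\<lambda>(i, t). d t $ i) ` (UNIV \<times> {1..T})"
    by force
  then have "finite {d t $ i | i t. t \<in> {1..T}}" by simp
  then show ?thesis unfolding max_demand_def using assms by (intro Max_ge) auto
qed

theorem theorem5p10:
  fixes l :: "'v::finite \<Rightarrow> 'v \<Rightarrow> real" and T :: nat and \<rho> :: real
    and d :: "nat \<Rightarrow> real ^ 'v"
  assumes "\<And>i. l i i = 0"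
    and "\<And>i j. i \<noteq> j \<Longrightarrow> l i j = 1"
    and "T \<ge> 1"
    and "d \<in> distribution_seqs T"
    and "max_demand T d = 1 / \<rho>"
  shows "expected_welfare l T (composite T (sqrt (\<rho> / real CARD('v)))) d
           \<ge> 1 / (2 * exp 1) * sqrt (\<rho> / real CARD('v)) * opt_welfare l T d"
proof -
  obtain N where T: "T = Suc N" using assms(3) by (cases T) auto
  note l = assms(1,2)
  have d: "d \<in> distribution_seqs (Suc N)" using assms(4) T by simp
  have dd: "is_distribution (d (Suc n))" if "n \<le> N" for n
    using d that by (auto simp: distribution_seqs_def)
  have le: "d (Suc n) $ i \<le> 1 / \<rho>" if "n \<le> N" for n i
    using max_demand_ge[of "Suc n" T d i] assms(5) that T by simp
  \<comment> \<open>The range of \<open>\<rho>\<close> follows from the first demand: its mass 1 is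
    spread over entries of at most \<open>1 / \<rho>\<close>. This also rules out
    \<open>\<rho> = 0\<close>, where the quotient would be 0.\<close>
  have "1 = (\<Sum>i\<in>UNIV. d (Suc 0) $ i)" using dd[of 0] by (simp add: is_distribution_def)
  also have "\<dots> \<le> (\<Sum>i\<in>(UNIV :: 'v set). 1 / \<rho>)" using le[of 0] by (intro sum_mono) simp
  finally have "1 \<le> real CARD('v) / \<rho>" by simp
  then have \<rho>: "0 < \<rho>" "\<rho> \<le> real CARD('v)"
    by (auto simp: le_divide_eq_1)
  define p where "p = sqrt (\<rho> / real CARD('v))"
  have p: "0 < p" "p \<le> 1" and pp: "p * p = \<rho> / real CARD('v)"
    using \<rho> by (auto simp: p_def)
  have stay: "social_welfare l T (run_alg stay d) d \<ge> real T * (p * p)"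
    unfolding T pp by (rule social_welfare_stay[OF l d \<rho>]) (simp_all add: le)
  have rand: "expected_welfare l T (rand_alg T p) d =
      1 + (\<Sum>n<N. smooth p (\<lambda>m. demand_served (d (Suc m)) (d (Suc (Suc n)))) n)"
    unfolding T by (rule expected_welfare_rand[OF l d]) (use p in auto)
  define W where "W = (\<Sum>n<N. smooth p (\<lambda>m. demand_served (d (Suc m)) (d (Suc (Suc n)))) n)"
  have W: "W \<ge> 0"
    unfolding W_def using p dd by (intro sum_nonneg smooth_nonneg demand_served_nonneg) auto
  have "opt_welfare l T d \<le> 1 + p * real T + W / p"
    unfolding opt_welfare_def
  proof (rule cSUP_least)
    show "distribution_seqs T \<noteq> ({} :: (nat \<Rightarrow> real ^ 'v) set)" using assms(4) by blast
    fix s :: "nat \<Rightarrow> real ^ 'v" assume s: "s \<in> distribution_seqs T"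
    then have "is_distribution (s (Suc n))" if "n \<le> N" for n
      using that T by (auto simp: distribution_seqs_def)
    with supply_bound[OF p, of N "\<lambda>n. s (Suc n)" "\<lambda>n. d (Suc n)"] dd s
    show "social_welfare l T s d \<le> 1 + p * real T + W / p"
      by (simp add: T social_welfare_unit[OF l] W_def)
  qed
  then have "p * opt_welfare l T d \<le> p * (1 + p * real T + W / p)"
    using p by (intro mult_left_mono) auto
  \<comment> \<open>Multiplying by \<open>p\<close> turns the bound into the guarantee of
    \<open>stay\<close> plus the welfare of \<open>rand_alg\<close>; the constant \<open>p\<close>
    is rounded up to 1.\<close>
  also have "\<dots> \<le> real T * (p * p) + (1 + W)"
    using p by (simp add: algebra_simps)
  also have welfare: "\<dots> \<le> 2 * expected_welfare l T (composite T p) d"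
    using stay rand by (simp add: expected_welfare_composite W_def)
  finally have opt: "p * opt_welfare l T d \<le> 2 * expected_welfare l T (composite T p) d" .
  \<comment> \<open>Weakening the ratio \<open>p / 2\<close> by the factor \<open>1 / exp 1\<close>
    requires a nonnegative expected welfare.\<close>
  have "0 \<le> real T * (p * p) + (1 + W)" using p W by simp
  also note welfare
  finally have nonneg: "0 \<le> expected_welfare l T (composite T p) d" by simp
  have "1 / (2 * exp 1) * p * opt_welfare l T d = 1 / (2 * exp 1) * (p * opt_welfare l T d)"
    by simp
  also have "\<dots> \<le> 1 / (2 * exp 1) * (2 * expected_welfare l T (composite T p) d)"
    using opt by (intro mult_left_mono) auto
  also have "\<dots> \<le> expected_welfare l T (composite T p) d"
    using nonneg by (simp add: divide_le_eq mult_le_cancel_left1)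
  finally show ?thesis unfolding p_def .
qed

end
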